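(* Let $X$ be a strongly collapsible simplicial complex, equipped with a locally total order on its vertices, with a strong collapse sequence $X=X_m,X_{m-1},\dots,X_0=\{a\}$, where for $1\le k\le m$ the complex $X_{k-1}$ is obtained from $X_k$ by the elementary strong collapse removing a vertex $v_k$ dominated in $X_k$ by a vertex $v_k'$. Let $r_k:X_k\to X_{k-1}$ be the simplicial map with $r_k(v_k)=v_k'$ and $r_k(u)=u$ for all vertices $u\ne v_k$, and define simplicial maps $f_k:X\to X_k$ by $f_m=\mathrm{id}_X$ and $f_{k-1}=r_k\circ f_k$ for $k\in\{1,\dots,m\}$. Let $K_m$ be the $m$-step product complex of $|X|\times[0,1]$, and define $\Psi$ on the vertices of $K_m$ by $$\Psi(v,t_k)=f_k(v),\qquad v\in X^0,\ t_k=\tfrac km,\ 0\le k\le m.$$ Then $\Psi$ is a discrete contraction; that is, $\Psi$ is a simplicial map $K_m\to X$ with $\Psi(\cdot,0)=\pi$ and $\Psi(\cdot,1)=\mathrm{id}_X$, where $\pi:X\to[a]$ is the simplicial map sending every vertex to $a$.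
   Context: A vertex $v$ of a simplicial complex $Y$ is dominated by another vertex $v'\neq v$ if every maximal simplex of $Y$ containing $v$ also contains $v'$. An elementary strong collapse removes from $Y$ a dominated vertex $v$ and all (open) simplices containing it. $X$ is strongly collapsible if some finite sequence of elementary strong collapses reduces it to a single vertex. A locally total order on $X^0$ (the vertex set of $X$) is a partial order whose restriction to the vertices of each simplex is total. For an interval $J=[s,t]$ with vertices $s<t$, the product complex $X\times J$ has vertex set $X^0\times\{s,t\}$ and its simplices are the sets $\{(y_0,\tau_0),\dots,(y_p,\tau_p)\}$ that are totally ordered under the product order ($(x,i)\le(x',i')$ iff $x\le x'$ and $i\le i'$) and whose first coordinates span a simplex of $X$. The $m$-step product complex is $K_m=\bigcup_{i=0}^{m-1}X\times[\tfrac im,\tfrac{i+1}m]$, with vertex set $X^0\times\{0,\tfrac1m,\dots,1\}$ and $|K_m|=|X|\times[0,1]$. A simplicial map is a map of vertices sending the vertex set of each simplex onto the vertex set of a simplex. *)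

theory Defs
  imports Complex_Main
begin

text \<open>
  Abstract simplicial complexes: a complex is identified with the set of vertex sets of its
  nonempty simplices, so the vertices are exactly the points that span a singleton.
\<close>

definition abstract_simplicial_complex :: "'a set set \<Rightarrow> bool" where
  "abstract_simplicial_complex X \<longleftrightarrow>
     (\<forall>\<sigma>\<in>X. finite \<sigma> \<and> \<sigma> \<noteq> {}) \<and>
     (\<forall>\<sigma>\<in>X. \<forall>\<tau>. \<tau> \<subseteq> \<sigma> \<and> \<tau> \<noteq> {} \<longrightarrow> \<tau> \<in> X)"

definition vertices :: "'a set set \<Rightarrow> 'a set" where
  "vertices X = \<Union>X"

definition maximal_simplex :: "'a set set \<Rightarrow> 'a set \<Rightarrow> bool" where
  "maximal_simplex X \<sigma> \<longleftrightarrow> \<sigma> \<in> X \<and> (\<forall>\<tau>\<in>X. \<sigma> \<subseteq> \<tau> \<longrightarrow> \<tau> = \<sigma>)"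

text \<open>
  Only the values on \<open>vertices X\<close> matter. Taking \<open>\<sigma>\<close> to be a singleton shows that vertices
  go to vertices.
\<close>

definition simplicial_map :: "'a set set \<Rightarrow> 'b set set \<Rightarrow> ('a \<Rightarrow> 'b) \<Rightarrow> bool" where
  "simplicial_map X Y f \<longleftrightarrow> (\<forall>\<sigma>\<in>X. f ` \<sigma> \<in> Y)"

definition dominated :: "'a set set \<Rightarrow> 'a \<Rightarrow> 'a \<Rightarrow> bool" where
  "dominated Y v v' \<longleftrightarrow>
     v \<in> vertices Y \<and> v' \<in> vertices Y \<and> v' \<noteq> v \<and>
     (\<forall>\<sigma>. maximal_simplex Y \<sigma> \<and> v \<in> \<sigma> \<longrightarrow> v' \<in> \<sigma>)"

definition remove_vertex :: "'a set set \<Rightarrow> 'a \<Rightarrow> 'a set set" where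
  "remove_vertex Y v = {\<sigma> \<in> Y. v \<notin> \<sigma>}"

definition elementary_strong_collapse :: "'a set set \<Rightarrow> 'a set set \<Rightarrow> bool" where
  "elementary_strong_collapse Y Y' \<longleftrightarrow> (\<exists>v v'. dominated Y v v' \<and> Y' = remove_vertex Y v)"

definition strongly_collapsible :: "'a set set \<Rightarrow> bool" where
  "strongly_collapsible X \<longleftrightarrow> (\<exists>a. elementary_strong_collapse\<^sup>*\<^sup>* X {{a}})"

definition locally_total_order :: "'a set set \<Rightarrow> 'a rel \<Rightarrow> bool" where
  "locally_total_order X R \<longleftrightarrow>
     partial_order_on (vertices X) R \<and> (\<forall>\<sigma>\<in>X. total_on \<sigma> R)"

definition product_order :: "'a rel \<Rightarrow> 'a \<times> real \<Rightarrow> 'a \<times> real \<Rightarrow> bool" where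
  "product_order R p q \<longleftrightarrow> (fst p, fst q) \<in> R \<and> snd p \<le> snd q"

text \<open>
  The product of \<open>X\<close> with the interval \<open>[s, t]\<close>. The condition on the first coordinates
  makes every member nonempty.
\<close>

definition product_complex :: "'a set set \<Rightarrow> 'a rel \<Rightarrow> real \<Rightarrow> real \<Rightarrow> ('a \<times> real) set set" where
  "product_complex X R s t =
     {S. S \<subseteq> vertices X \<times> {s, t} \<and>
         (\<forall>p\<in>S. \<forall>q\<in>S. product_order R p q \<or> product_order R q p) \<and>
         fst ` S \<in> X}"

definition step_product_complex :: "'a set set \<Rightarrow> 'a rel \<Rightarrow> nat \<Rightarrow> ('a \<times> real) set set" where
  "step_product_complex X R m =
     (\<Union>i<m. product_complex X R (real i / real m) (real (i + 1) / real m))"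

definition discrete_contraction ::
  "'a set set \<Rightarrow> 'a rel \<Rightarrow> nat \<Rightarrow> 'a \<Rightarrow> ('a \<times> real \<Rightarrow> 'a) \<Rightarrow> bool" where
  "discrete_contraction X R m a \<Psi> \<longleftrightarrow>
     simplicial_map (step_product_complex X R m) X \<Psi> \<and>
     (\<forall>v\<in>vertices X. \<Psi> (v, 0) = a) \<and>
     (\<forall>v\<in>vertices X. \<Psi> (v, 1) = v)"

text \<open>
  The retraction attached to an elementary strong collapse of a finite complex is
  automatically simplicial, so it may be specified by its values on vertices alone.
\<close>

lemma strong_collapse_retraction_simplicial:
  assumes X: "abstract_simplicial_complex X" and fin: "finite X" and dom: "dominated X v v'"
    and rv: "r v = v'" and ru: "\<And>u. u \<in> vertices X \<Longrightarrow> u \<noteq> v \<Longrightarrow> r u = u"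
  shows "simplicial_map X (remove_vertex X v) r"
  unfolding simplicial_map_def
proof
  fix \<sigma> assume s: "\<sigma> \<in> X"
  obtain \<tau> where t: "\<tau> \<in> X" "\<sigma> \<subseteq> \<tau>" "\<forall>\<rho>\<in>X. \<tau> \<subseteq> \<rho> \<longrightarrow> \<rho> = \<tau>"
    using finite_has_maximal2[OF fin s] by auto
  have v't: "v' \<in> \<tau>" if "v \<in> \<sigma>"
    using dom t that unfolding dominated_def maximal_simplex_def by blast
  have r: "r u \<in> \<tau> \<and> r u \<noteq> v" if "u \<in> \<sigma>" for u
  proof (cases "u = v")
    case True
    then show ?thesis using rv v't that dom by (auto simp: dominated_def)
  next
    case False
    moreover have "u \<in> vertices X" using that s by (auto simp: vertices_def)
    ultimately show ?thesis using ru that t(2) by auto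
  qed
  have "r ` \<sigma> \<subseteq> \<tau>" "v \<notin> r ` \<sigma>" using r by blast+
  moreover have "r ` \<sigma> \<noteq> {}" using X s unfolding abstract_simplicial_complex_def by auto
  ultimately show "r ` \<sigma> \<in> remove_vertex X v"
    using X t(1) unfolding abstract_simplicial_complex_def remove_vertex_def by blast
qed

end

theory Submission
  imports Defs
begin

text \<open>
  A maximal simplex through a simplex \<open>\<sigma>\<close> of \<open>X\<^sub>k\<close> also contains \<open>r\<^sub>k(\<sigma>)\<close>, so \<open>r\<^sub>k\<close> is contiguous to
  the identity of \<open>X\<^sub>k\<close>. Hence the maps \<open>f\<^sub>k\<close> and \<open>f\<^sub>k\<^sub>-\<^sub>1 = r\<^sub>k \<circ> f\<^sub>k\<close> are contiguous, and the image of a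
  simplex of a slab, being contained in the union of the two images of its projection to \<open>X\<close>, is a
  simplex. Maximal simplices exist because \<open>X\<close> has at most \<open>m + 1\<close> vertices.
\<close>

lemma simplex_subset:
  "abstract_simplicial_complex X \<Longrightarrow> \<sigma> \<in> X \<Longrightarrow> \<tau> \<subseteq> \<sigma> \<Longrightarrow> \<tau> \<noteq> {} \<Longrightarrow> \<tau> \<in> X"
  unfolding abstract_simplicial_complex_def by blast

lemma simplex_nonempty: "abstract_simplicial_complex X \<Longrightarrow> \<sigma> \<in> X \<Longrightarrow> \<sigma> \<noteq> {}"
  unfolding abstract_simplicial_complex_def by blast

lemma abstract_simplicial_complex_remove_vertex:
  "abstract_simplicial_complex X \<Longrightarrow> abstract_simplicial_complex (remove_vertex X v)"
  unfolding abstract_simplicial_complex_def remove_vertex_def by blast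

lemma vertices_subset_insert_remove_vertex:
  assumes "abstract_simplicial_complex X"
  shows "vertices X \<subseteq> insert v (vertices (remove_vertex X v))"
proof
  fix u assume "u \<in> vertices X"
  \<comment> \<open>A vertex other than \<open>v\<close> survives the removal through its own
    singleton, even if every larger simplex around it contains \<open>v\<close>.\<close>
  then have "{u} \<in> X"
    using simplex_subset[OF assms, of _ "{u}"] by (auto simp: vertices_def)
  then show "u \<in> insert v (vertices (remove_vertex X v))"
    by (auto simp: vertices_def remove_vertex_def)
qed

lemma finite_complex_iff_finite_vertices:
  assumes "abstract_simplicial_complex X"
  shows "finite X \<longleftrightarrow> finite (vertices X)"
proof
  assume "finite X"
  then show "finite (vertices X)"
    using assms by (simp add: vertices_def abstract_simplicial_complex_def)
next
  assume "finite (vertices X)"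
  then show "finite X"
    unfolding vertices_def by (rule finite_UnionD)
qed

text \<open>Undoing a removal may restore many simplices but only one vertex, so finiteness is
  tracked on vertex sets.\<close>

lemma finite_of_finite_remove_vertex:
  assumes "abstract_simplicial_complex X" "finite (remove_vertex X v)"
  shows "finite X"
proof -
  have "finite (vertices (remove_vertex X v))"
    using finite_complex_iff_finite_vertices[OF
        abstract_simplicial_complex_remove_vertex[OF assms(1)]] assms(2) by simp
  then show ?thesis
    using finite_subset[OF vertices_subset_insert_remove_vertex[OF assms(1), of v]]
      finite_complex_iff_finite_vertices[OF assms(1)] by simp
qed

lemma strong_collapse_retraction_contiguous_id:
  assumes X: "abstract_simplicial_complex X" and fin: "finite X" and dom: "dominated X v v'"
    and rv: "r v = v'" and ru: "\<And>u. u \<in> vertices X \<Longrightarrow> u \<noteq> v \<Longrightarrow> r u = u"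
    and s: "\<sigma> \<in> X"
  shows "\<sigma> \<union> r ` \<sigma> \<in> X"
proof -
  obtain \<tau> where t: "\<tau> \<in> X" "\<sigma> \<subseteq> \<tau>" "\<forall>\<rho>\<in>X. \<tau> \<subseteq> \<rho> \<longrightarrow> \<rho> = \<tau>"
    using finite_has_maximal2[OF fin s] by auto
  have "r u \<in> \<tau>" if u: "u \<in> \<sigma>" for u
  proof (cases "u = v")
    case True
    then show ?thesis
      using dom t u rv unfolding dominated_def maximal_simplex_def by blast
  next
    case False
    moreover have "u \<in> vertices X" using u s by (auto simp: vertices_def)
    ultimately show ?thesis using ru u t(2) by auto
  qed
  then have "\<sigma> \<union> r ` \<sigma> \<subseteq> \<tau>" using t(2) by blast
  then show ?thesis
    using simplex_subset[OF X t(1)] simplex_nonempty[OF X s] by blast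
qed

text \<open>Contiguity of \<open>g\<close> and \<open>h\<close> is exactly what a slab needs: its
  simplices mix vertices from both ends, so the two images must lie in a common simplex.\<close>

lemma simplicial_map_product_complex:
  assumes Y: "abstract_simplicial_complex Y"
    and contig: "\<And>\<sigma>. \<sigma> \<in> X \<Longrightarrow> g ` \<sigma> \<union> h ` \<sigma> \<in> Y"
    and s: "\<And>x. x \<in> vertices X \<Longrightarrow> F (x, s) = g x"
    and t: "\<And>x. x \<in> vertices X \<Longrightarrow> F (x, t) = h x"
  shows "simplicial_map (product_complex X R s t) Y F"
  unfolding simplicial_map_def
proof
  fix S assume "S \<in> product_complex X R s t"
  then have S: "S \<subseteq> vertices X \<times> {s, t}" and X: "fst ` S \<in> X"
    by (auto simp: product_complex_def)
  have "F p \<in> g ` fst ` S \<union> h ` fst ` S" if p: "p \<in> S" for p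
  proof -
    have "F p = g (fst p) \<or> F p = h (fst p)"
      using p S s t by (cases p) auto
    then show ?thesis using p by auto
  qed
  then have "F ` S \<subseteq> g ` fst ` S \<union> h ` fst ` S"
    by blast
  moreover have "F ` S \<noteq> {}"
    using simplex_nonempty[OF Y contig[OF X]] by auto
  ultimately show "F ` S \<in> Y"
    using simplex_subset[OF Y contig[OF X]] by blast
qed

theorem proposition6p8:
  fixes X :: "'a set set"
    and R :: "'a rel"
    and m :: nat
    and Xs :: "nat \<Rightarrow> 'a set set"
    and a :: 'a
    and v v' :: "nat \<Rightarrow> 'a"
    and r f :: "nat \<Rightarrow> 'a \<Rightarrow> 'a"
    and \<Psi> :: "'a \<times> real \<Rightarrow> 'a"
  assumes "abstract_simplicial_complex X"
    and "strongly_collapsible X"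
    and "locally_total_order X R"
    and "m \<ge> 1"
    and "Xs m = X"
    and "Xs 0 = {{a}}"
    and "\<And>k. k \<in> {1..m} \<Longrightarrow> dominated (Xs k) (v k) (v' k)"
    and "\<And>k. k \<in> {1..m} \<Longrightarrow> Xs (k - 1) = remove_vertex (Xs k) (v k)"
    and "\<And>k. k \<in> {1..m} \<Longrightarrow> r k (v k) = v' k"
    and "\<And>k u. k \<in> {1..m} \<Longrightarrow> u \<in> vertices (Xs k) \<Longrightarrow> u \<noteq> v k \<Longrightarrow> r k u = u"
    and "\<And>x. x \<in> vertices X \<Longrightarrow> f m x = x"
    and "\<And>k x. k \<in> {1..m} \<Longrightarrow> x \<in> vertices X \<Longrightarrow> f (k - 1) x = r k (f k x)"
    and "\<And>k x. k \<le> m \<Longrightarrow> x \<in> vertices X \<Longrightarrow> \<Psi> (x, real k / real m) = f k x"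
  shows "discrete_contraction X R m a \<Psi>"
proof -
  have Xs_step: "Xs k = remove_vertex (Xs (Suc k)) (v (Suc k))" if "k < m" for k
    using assms(8)[of "Suc k"] that by simp
  \<comment> \<open>Downward induction, since these properties are inherited from
    \<open>X = Xs m\<close>.\<close>
  have "abstract_simplicial_complex (Xs k) \<and> Xs k \<subseteq> X" if "k \<le> m" for k
    using that
  proof (induction rule: inc_induct)
    case base
    then show ?case using assms(1,5) by simp
  next
    case (step k)
    then show ?case
      using abstract_simplicial_complex_remove_vertex[of "Xs (Suc k)"] Xs_step[of k]
      by (auto simp: remove_vertex_def)
  qed
  then have cplx: "abstract_simplicial_complex (Xs k)" and sub: "Xs k \<subseteq> X" if "k \<le> m" for k
    using that by blast+
  \<comment> \<open>Here the induction runs upward: finiteness is given at the single vertex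
    \<open>{{a}}\<close> and passes back through each collapse.\<close>
  have fin: "finite (Xs k)" if "k \<le> m" for k
    using that
  proof (induction k)
    case 0
    then show ?case using assms(6) by simp
  next
    case (Suc k)
    then show ?case
      using finite_of_finite_remove_vertex[OF cplx[of "Suc k"]] Xs_step[of k] by simp
  qed
  have retr: "simplicial_map (Xs (Suc k)) (Xs k) (r (Suc k))"
    and contig: "\<And>\<sigma>. \<sigma> \<in> Xs (Suc k) \<Longrightarrow> \<sigma> \<union> r (Suc k) ` \<sigma> \<in> Xs (Suc k)" if "k < m" for k
  proof -
    have k: "Suc k \<in> {1..m}" "Suc k \<le> m" using that by auto
    note facts = cplx[OF k(2)] fin[OF k(2)] assms(7)[OF k(1)] assms(9)[OF k(1)] assms(10)[OF k(1)]
    show "simplicial_map (Xs (Suc k)) (Xs k) (r (Suc k))"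
      using strong_collapse_retraction_simplicial[OF facts] Xs_step[OF that] by simp
    show "\<sigma> \<union> r (Suc k) ` \<sigma> \<in> Xs (Suc k)" if "\<sigma> \<in> Xs (Suc k)" for \<sigma>
      using strong_collapse_retraction_contiguous_id[OF facts that] .
  qed
  have f_step: "f k ` \<sigma> = r (Suc k) ` f (Suc k) ` \<sigma>" if "k < m" "\<sigma> \<in> X" for k \<sigma>
  proof -
    have "f k x = r (Suc k) (f (Suc k) x)" if "x \<in> \<sigma>" for x
      using assms(12)[of "Suc k" x] \<open>k < m\<close> \<open>\<sigma> \<in> X\<close> that by (auto simp: vertices_def)
    then show ?thesis by (simp add: image_image)
  qed
  \<comment> \<open>The target \<open>Xs k\<close>, sharper than \<open>X\<close>, lets the next
    retraction act and pins down \<open>f 0\<close>.\<close>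
  have f_simp: "f k ` \<sigma> \<in> Xs k" if "k \<le> m" "\<sigma> \<in> X" for k \<sigma>
    using that(1)
  proof (induction rule: inc_induct)
    case base
    have "f m ` \<sigma> = id ` \<sigma>"
      using assms(11) that(2) by (intro image_cong) (auto simp: vertices_def)
    then show ?case using assms(5) that(2) by simp
  next
    case (step k)
    then show ?case
      using retr[of k] f_step[OF _ that(2), of k] by (simp add: simplicial_map_def)
  qed
  have "simplicial_map (product_complex X R (real i / real m) (real (i + 1) / real m)) X \<Psi>"
    if i: "i < m" for i
  proof (rule simplicial_map_product_complex[OF assms(1)])
    fix \<sigma> assume \<sigma>: "\<sigma> \<in> X"
    \<comment> \<open>Contiguity of \<open>r (Suc i)\<close> with the identity is applied to the
      simplex \<open>f (Suc i)\<close>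
      \<sigma>\<open>;\<close>f_step\<open>then turns the second image into\<close>f i
      \<open>\<sigma>\<close>.\<close>
    have "f (Suc i) ` \<sigma> \<union> r (Suc i) ` f (Suc i) ` \<sigma> \<in> X"
      using contig[OF i f_simp[of "Suc i" \<sigma>]] sub[of "Suc i"] i \<sigma> by auto
    then show "f i ` \<sigma> \<union> f (i + 1) ` \<sigma> \<in> X"
      using f_step[OF i \<sigma>] by (simp add: Un_commute)
  next
    show "\<Psi> (x, real i / real m) = f i x" "\<Psi> (x, real (i + 1) / real m) = f (i + 1) x"
      if "x \<in> vertices X" for x
      using assms(13)[of i x] assms(13)[of "i + 1" x] i that by simp_all
  qed
  then have "simplicial_map (step_product_complex X R m) X \<Psi>"
    unfolding simplicial_map_def step_product_complex_def by blast
  moreover have "\<Psi> (x, 0) = a" if "x \<in> vertices X" for x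
  proof -
    obtain \<sigma> where "\<sigma> \<in> X" "x \<in> \<sigma>" using \<open>x \<in> vertices X\<close> by (auto simp: vertices_def)
    \<comment> \<open>The only simplex of \<open>Xs 0\<close> is \<open>{a}\<close>, so
      \<open>f 0\<close> collapses all of \<open>\<sigma>\<close> to \<open>a\<close>.\<close>
    then have "f 0 x = a" using f_simp[of 0 \<sigma>] assms(6) by auto
    then show ?thesis using assms(13)[of 0 x] that by simp
  qed
  moreover have "\<Psi> (x, 1) = x" if "x \<in> vertices X" for x
    \<comment> \<open>\<open>m \<ge> 1\<close> makes \<open>real m / real m\<close> equal to 1; for
      \<open>m = 0\<close> the quotient would be 0.\<close>
    using assms(13)[of m x] assms(4) assms(11) that by simp
  ultimately show ?thesis
    unfolding discrete_contraction_def by blast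
qed

end
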